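(* Let $\alpha\in\mathbf{R}\setminus\mathbf{Q}$. Let $D=\{z\in\mathbf{C}: |z|\le 1\}$ carry the subset diffeology of $\mathbf{C}$, let $D_\alpha=D/\mathbf{Z}$ be the diffeological quotient by the action $n\cdot z=z e^{i2\pi n\alpha}$, let $W_\alpha=(D\times\mathbf{R})/\mathbf{Z}$ be the diffeological quotient by the action $n\cdot(z,t)=(z e^{i2\pi n\alpha},\,t+n|z|^2)$, and let $\pi:W_\alpha\to D_\alpha$, $\pi([z,t])=[z]$, be regarded as an $(\mathbf{R},+)$-principal bundle for the action $s\cdot[z,t]=[z,t+s]$ of $\mathbf{R}$ on $W_\alpha$. Then $\pi:W_\alpha\to D_\alpha$ does not admit a connection in the (broad) sense of diffeology.
   Context: All spaces are diffeological spaces. Quotients carry the quotient diffeology (a parametrization is a plot if and only if it lifts locally along the quotient map to plots of the source), subsets the subset diffeology, products the product diffeology. Principal bundle: let $G$ be a diffeological group acting smoothly on a diffeological space $Y$, and let $\pi:Y\to X$ be (up to isomorphism) the quotient projection $Y\to Y/G$. Then $\pi$ is a $G$-principal bundle if the map $F:Y\times G\to Y\times Y$, $F(y,g)=(y,g\cdot y)$, is an induction (injective and a diffeomorphism onto its image equipped with the subset diffeology). Local paths: $\mathrm{Paths}_{\mathrm{loc}}(Y)$ is the set of smooth maps $\gamma$ from an open interval $\mathrm{def}(\gamma)\subseteq\mathbf{R}$ to $Y$, with its functional diffeology: $r\mapsto\gamma_r$, defined on a Euclidean domain $U$, is a plot if and only if $\{(r,t): r\in U,\ t\in\mathrm{def}(\gamma_r)\}$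 is open and $(r,t)\mapsto\gamma_r(t)$ is smooth on it. Let $\mathrm{tbPaths}_{\mathrm{loc}}(Y)=\{(\gamma,t)\in\mathrm{Paths}_{\mathrm{loc}}(Y)\times\mathbf{R} : t\in\mathrm{def}(\gamma)\}$ with the subset diffeology. Connection (in the sense of P. Iglesias-Zemmour's book "Diffeology"): a connection on a $G$-principal bundle $\pi:Y\to X$ is a smooth map $\Theta:\mathrm{tbPaths}_{\mathrm{loc}}(Y)\to\mathrm{Paths}_{\mathrm{loc}}(Y)$ such that, for all $(\gamma,t_0)\in\mathrm{tbPaths}_{\mathrm{loc}}(Y)$: (1) Domain: $\mathrm{def}(\Theta(\gamma,t_0))=\mathrm{def}(\gamma)$. (2) Lifting: $\pi\circ\Theta(\gamma,t_0)=\pi\circ\gamma$. (3) Basepoint: $\Theta(\gamma,t_0)(t_0)=\gamma(t_0)$. (4) Reduction: $\Theta(g\cdot\gamma,t_0)=g(t_0)\cdot\Theta(\gamma,t_0)$ for every smooth path $g:\mathrm{def}(\gamma)\to G$, where $(g\cdot\gamma)(t)=g(t)\cdot\gamma(t)$. (5) Locality: $\Theta(\gamma\circ f,s)=\Theta(\gamma,f(s))\circ f$ for every smooth map $f$ from an open interval into $\mathrm{def}(\gamma)$ and every $s\in\mathrm{def}(f)$. (6) Projector: $\Theta(\Theta(\gamma,t_0),t_0)=\Theta(\gamma,t_0)$. Here $Y=W_\alpha$, $X=D_\alpha$, $G=(\mathbf{R},+)$. *)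

theory Defs
  imports "HOL-Analysis.Analysis"
begin

section \<open>Smooth functions on Euclidean domains\<close>

text \<open>
  The dimension of a parametrization has to range over all natural numbers, so \<open>R\<^sup>n\<close> is the
  library space \<^const>\<open>Euclidean_space\<close> \<open>n\<close>: the functions \<open>nat \<Rightarrow> real\<close> vanishing from index
  \<open>n\<close> on, with the product topology. For open \<open>U\<close> the predicate says that all iterated partial
  derivatives of \<open>f\<close> up to order \<open>k\<close> exist and are continuous on \<open>U\<close>.
\<close>

primrec Ck_on :: "nat \<Rightarrow> nat \<Rightarrow> (nat \<Rightarrow> real) set \<Rightarrow> ((nat \<Rightarrow> real) \<Rightarrow> real) \<Rightarrow> bool" where
  "Ck_on 0 n U f \<longleftrightarrow> continuous_on U f"
| "Ck_on (Suc k) n U f \<longleftrightarrow> continuous_on U f \<and>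
     (\<forall>i<n. \<exists>f'. (\<forall>x\<in>U. ((\<lambda>t. f (x(i := t))) has_real_derivative f' x) (at (x i))) \<and>
                Ck_on k n U f')"

definition smooth_on :: "nat \<Rightarrow> (nat \<Rightarrow> real) set \<Rightarrow> ((nat \<Rightarrow> real) \<Rightarrow> real) \<Rightarrow> bool" where
  "smooth_on n U f \<longleftrightarrow> (\<forall>k. Ck_on k n U f)"


section \<open>Diffeological spaces\<close>

text \<open>
  A parametrization defined on a subset of \<open>R\<^sup>n\<close> is a partial map whose \<^const>\<open>dom\<close> is that
  subset; thus equality of parametrizations (and, below, of local paths) includes equality of
  their domains. \<open>plots X n\<close> is the set of plots of \<open>X\<close> defined on open subsets of \<open>R\<^sup>n\<close>.
\<close>

type_synonym 'a param = "(nat \<Rightarrow> real) \<rightharpoonup> 'a"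

record 'a diffspace =
  points :: "'a set"
  plots :: "nat \<Rightarrow> 'a param set"

definition real_diff :: "real diffspace" where
  "real_diff = \<lparr>points = UNIV,
     plots = (\<lambda>n. {p. openin (Euclidean_space n) (dom p) \<and>
                      smooth_on n (dom p) (\<lambda>x. the (p x))})\<rparr>"

definition complex_diff :: "complex diffspace" where
  "complex_diff = \<lparr>points = UNIV,
     plots = (\<lambda>n. {p. openin (Euclidean_space n) (dom p) \<and>
                      smooth_on n (dom p) (\<lambda>x. Re (the (p x))) \<and>
                      smooth_on n (dom p) (\<lambda>x. Im (the (p x)))})\<rparr>"

definition sub_diff :: "'a diffspace \<Rightarrow> 'a set \<Rightarrow> 'a diffspace" where
  "sub_diff X A = \<lparr>points = points X \<inter> A, plots = (\<lambda>n. {p \<in> plots X n. ran p \<subseteq> A})\<rparr>"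

definition prod_diff :: "'a diffspace \<Rightarrow> 'b diffspace \<Rightarrow> ('a \<times> 'b) diffspace" where
  "prod_diff X Y = \<lparr>points = points X \<times> points Y,
     plots = (\<lambda>n. {p. map_option fst \<circ> p \<in> plots X n \<and> map_option snd \<circ> p \<in> plots Y n})\<rparr>"

text \<open>The lifts \<open>q\<close> below have open domains, because they are plots of \<open>X\<close>.\<close>

definition quotient_diff :: "'a diffspace \<Rightarrow> ('a \<times> 'a) set \<Rightarrow> 'a set diffspace" where
  "quotient_diff X r = \<lparr>points = points X // r,
     plots = (\<lambda>n. {p. openin (Euclidean_space n) (dom p) \<and>
       (\<forall>x\<in>dom p. \<exists>q\<in>plots X n. x \<in> dom q \<and> (map_option (\<lambda>a. r `` {a}) \<circ> q) \<subseteq>\<^sub>m p)})\<rparr>"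

definition smooth_map :: "'a diffspace \<Rightarrow> 'b diffspace \<Rightarrow> ('a \<Rightarrow> 'b) \<Rightarrow> bool" where
  "smooth_map X Y f \<longleftrightarrow> f ` points X \<subseteq> points Y \<and>
     (\<forall>n. \<forall>p\<in>plots X n. map_option f \<circ> p \<in> plots Y n)"


section \<open>Local paths\<close>

definition local_paths :: "'a diffspace \<Rightarrow> (real \<rightharpoonup> 'a) set" where
  "local_paths Y = {\<gamma>. open (dom \<gamma>) \<and> is_interval (dom \<gamma>) \<and>
     smooth_map (sub_diff real_diff (dom \<gamma>)) Y (\<lambda>t. the (\<gamma> t))}"

text \<open>
  A pair \<open>(r, t)\<close> with \<open>r \<in> R\<^sup>n\<close> is the point \<open>r(n := t)\<close> of \<open>R\<^sup>n\<^sup>+\<^sup>1\<close>. So the partial map below is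
  \<open>(r, t) \<mapsto> \<gamma>\<^sub>r(t)\<close>, with domain \<open>{(r, t). r \<in> U, t \<in> def(\<gamma>\<^sub>r)}\<close>.
\<close>

definition uncurry_family :: "nat \<Rightarrow> (real \<rightharpoonup> 'a) param \<Rightarrow> 'a param" where
  "uncurry_family n P = (\<lambda>x. case P (x(n := 0)) of None \<Rightarrow> None | Some \<gamma> \<Rightarrow> \<gamma> (x n))"

definition Paths_loc :: "'a diffspace \<Rightarrow> (real \<rightharpoonup> 'a) diffspace" where
  "Paths_loc Y = \<lparr>points = local_paths Y,
     plots = (\<lambda>n. {P. openin (Euclidean_space n) (dom P) \<and> ran P \<subseteq> local_paths Y \<and>
       openin (Euclidean_space (Suc n)) (dom (uncurry_family n P)) \<and>
       uncurry_family n P \<in> plots Y (Suc n)})\<rparr>"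

definition tbPaths_loc :: "'a diffspace \<Rightarrow> ((real \<rightharpoonup> 'a) \<times> real) diffspace" where
  "tbPaths_loc Y = sub_diff (prod_diff (Paths_loc Y) real_diff) {(\<gamma>, t). t \<in> dom \<gamma>}"


section \<open>Connections\<close>

record ('y, 'x, 'g) gbundle =
  total :: "'y diffspace"
  base :: "'x diffspace"
  grp :: "'g diffspace"
  gact :: "'g \<Rightarrow> 'y \<Rightarrow> 'y"
  bproj :: "'y \<Rightarrow> 'x"

text \<open>
  \<open>is_connection\<close> consists of the conditions on \<open>\<Theta>\<close> alone; these involve the total space, the
  projection and the group action. That the bundle is principal is not one of the conjuncts, so
  that nonexistence of a connection cannot hold merely because the bundle fails to be principal.
\<close>

definition is_connection ::
  "('y, 'x, 'g) gbundle \<Rightarrow> ((real \<rightharpoonup> 'y) \<times> real \<Rightarrow> (real \<rightharpoonup> 'y)) \<Rightarrow> bool" where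
  "is_connection B \<Theta> \<longleftrightarrow>
     smooth_map (tbPaths_loc (total B)) (Paths_loc (total B)) \<Theta> \<and>
     (\<forall>(\<gamma>, t\<^sub>0) \<in> points (tbPaths_loc (total B)).
        \<comment> \<open>domain\<close>
        dom (\<Theta> (\<gamma>, t\<^sub>0)) = dom \<gamma> \<and>
        \<comment> \<open>lifting\<close>
        map_option (bproj B) \<circ> \<Theta> (\<gamma>, t\<^sub>0) = map_option (bproj B) \<circ> \<gamma> \<and>
        \<comment> \<open>basepoint\<close>
        \<Theta> (\<gamma>, t\<^sub>0) t\<^sub>0 = \<gamma> t\<^sub>0 \<and>
        \<comment> \<open>reduction\<close>
        (\<forall>g. smooth_map (sub_diff real_diff (dom \<gamma>)) (grp B) g \<longrightarrow>
           \<Theta> (\<lambda>t. map_option (gact B (g t)) (\<gamma> t), t\<^sub>0)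
             = map_option (gact B (g t\<^sub>0)) \<circ> \<Theta> (\<gamma>, t\<^sub>0)) \<and>
        \<comment> \<open>projector\<close>
        \<Theta> (\<Theta> (\<gamma>, t\<^sub>0), t\<^sub>0) = \<Theta> (\<gamma>, t\<^sub>0)) \<and>
     \<comment> \<open>locality\<close>
     (\<forall>\<gamma> \<in> local_paths (total B). \<forall>f \<in> local_paths real_diff. ran f \<subseteq> dom \<gamma> \<longrightarrow>
        (\<forall>s\<in>dom f. \<Theta> (\<gamma> \<circ>\<^sub>m f, s) = \<Theta> (\<gamma>, the (f s)) \<circ>\<^sub>m f))"


section \<open>The bundle $W_\alpha \to D_\alpha$\<close>

definition orbit_rel :: "(int \<Rightarrow> 'a \<Rightarrow> 'a) \<Rightarrow> 'a set \<Rightarrow> ('a \<times> 'a) set" where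
  "orbit_rel a A = {(x, y). x \<in> A \<and> (\<exists>n. y = a n x)}"

definition disc :: "complex set" where
  "disc = {z. cmod z \<le> 1}"

definition rot :: "real \<Rightarrow> int \<Rightarrow> complex \<Rightarrow> complex" where
  "rot \<alpha> n z = z * exp (\<i> * of_real (2 * pi * of_int n * \<alpha>))"

definition twist :: "real \<Rightarrow> int \<Rightarrow> complex \<times> real \<Rightarrow> complex \<times> real" where
  "twist \<alpha> n = (\<lambda>(z, t). (rot \<alpha> n z, t + of_int n * (cmod z)\<^sup>2))"

abbreviation D_rel :: "real \<Rightarrow> (complex \<times> complex) set" where
  "D_rel \<alpha> \<equiv> orbit_rel (rot \<alpha>) disc"

abbreviation W_rel :: "real \<Rightarrow> ((complex \<times> real) \<times> (complex \<times> real)) set" where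
  "W_rel \<alpha> \<equiv> orbit_rel (twist \<alpha>) (disc \<times> UNIV)"

definition D_space :: "real \<Rightarrow> complex set diffspace" where
  "D_space \<alpha> = quotient_diff (sub_diff complex_diff disc) (D_rel \<alpha>)"

definition W_space :: "real \<Rightarrow> (complex \<times> real) set diffspace" where
  "W_space \<alpha> =
     quotient_diff (prod_diff (sub_diff complex_diff disc) real_diff) (W_rel \<alpha>)"

definition W_proj :: "real \<Rightarrow> (complex \<times> real) set \<Rightarrow> complex set" where
  "W_proj \<alpha> c = (\<Union>(z, t)\<in>c. D_rel \<alpha> `` {z})"

definition W_act :: "real \<Rightarrow> real \<Rightarrow> (complex \<times> real) set \<Rightarrow> (complex \<times> real) set" where
  "W_act \<alpha> s c = (\<Union>(z, t)\<in>c. W_rel \<alpha> `` {(z, t + s)})"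

definition W_bundle :: "real \<Rightarrow> ((complex \<times> real) set, complex set, real) gbundle" where
  "W_bundle \<alpha> = \<lparr>total = W_space \<alpha>, base = D_space \<alpha>, grp = real_diff,
     gact = W_act \<alpha>, bproj = W_proj \<alpha>\<rparr>"

lemma cmod_rot [simp]: "cmod (rot \<alpha> n z) = cmod z"
  by (simp add: rot_def norm_mult)

lemma rot_0 [simp]: "rot \<alpha> 0 z = z"
  by (simp add: rot_def)

lemma rot_rot: "rot \<alpha> m (rot \<alpha> n z) = rot \<alpha> (n + m) z"
proof -
  have "exp (\<i> * of_real (2 * pi * of_int (n + m) * \<alpha>)) =
      exp (\<i> * of_real (2 * pi * of_int n * \<alpha>)) * exp (\<i> * of_real (2 * pi * of_int m * \<alpha>))"
    unfolding exp_add[symmetric] by (simp add: distrib_left distrib_right)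
  then show ?thesis
    by (simp add: rot_def mult.assoc)
qed

lemma equiv_orbit_rel:
  assumes "\<And>x. a 0 x = x" "\<And>m n x. a m (a n x) = a (n + m) x" "\<And>n x. x \<in> A \<Longrightarrow> a n x \<in> A"
  shows "equiv A (orbit_rel a A)"
proof (rule equivI)
  show "orbit_rel a A \<subseteq> A \<times> A"
    using assms(3) by (auto simp: orbit_rel_def)
  show "refl_on A (orbit_rel a A)"
  proof (rule refl_onI)
    fix x assume "x \<in> A"
    moreover have "x = a 0 x" using assms(1) by simp
    ultimately show "(x, x) \<in> orbit_rel a A"
      unfolding orbit_rel_def by blast
  qed
  show "sym (orbit_rel a A)"
  proof (rule symI)
    fix x y assume "(x, y) \<in> orbit_rel a A"
    then obtain n where n: "x \<in> A" "y = a n x" by (auto simp: orbit_rel_def)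
    have "x = a (- n) y" using assms(1,2) n(2) by simp
    moreover have "y \<in> A" using assms(3) n by simp
    ultimately show "(y, x) \<in> orbit_rel a A"
      unfolding orbit_rel_def by blast
  qed
  show "trans (orbit_rel a A)"
  proof (rule transI)
    fix x y z assume "(x, y) \<in> orbit_rel a A" "(y, z) \<in> orbit_rel a A"
    then obtain m n where "x \<in> A" "z = a m (a n x)" by (auto simp: orbit_rel_def)
    then show "(x, z) \<in> orbit_rel a A"
      using assms(2) unfolding orbit_rel_def by blast
  qed
qed

lemma equiv_D_rel: "equiv disc (D_rel \<alpha>)"
  by (rule equiv_orbit_rel) (auto simp: rot_rot disc_def)

lemma equiv_W_rel: "equiv (disc \<times> UNIV) (W_rel \<alpha>)"
  by (rule equiv_orbit_rel) (auto simp: twist_def rot_rot disc_def algebra_simps)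

lemma W_proj_class:
  assumes "z \<in> disc"
  shows "W_proj \<alpha> (W_rel \<alpha> `` {(z, t)}) = D_rel \<alpha> `` {z}"
proof -
  have "D_rel \<alpha> `` {w} = D_rel \<alpha> `` {z}" if "(w, u) \<in> W_rel \<alpha> `` {(z, t)}" for w u
    using that equiv_class_eq[OF equiv_D_rel, of z w \<alpha>] by (auto simp: orbit_rel_def twist_def)
  moreover have "(z, t) \<in> W_rel \<alpha> `` {(z, t)}"
    using assms by (intro equiv_class_self[OF equiv_W_rel]) auto
  ultimately show ?thesis
    unfolding W_proj_def by fast
qed

lemma W_act_class:
  assumes "z \<in> disc"
  shows "W_act \<alpha> s (W_rel \<alpha> `` {(z, t)}) = W_rel \<alpha> `` {(z, t + s)}"
proof -
  have "W_rel \<alpha> `` {(w, u + s)} = W_rel \<alpha> `` {(z, t + s)}" if "(w, u) \<in> W_rel \<alpha> `` {(z, t)}" for w u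
  proof -
    from that have "((z, t + s), (w, u + s)) \<in> W_rel \<alpha>"
      by (auto simp: orbit_rel_def twist_def algebra_simps)
    from equiv_class_eq[OF equiv_W_rel this] show ?thesis by simp
  qed
  moreover have "(z, t) \<in> W_rel \<alpha> `` {(z, t)}"
    using assms by (intro equiv_class_self[OF equiv_W_rel]) auto
  ultimately show ?thesis
    unfolding W_act_def by fast
qed

end

theory Submission
  imports Defs
begin

text \<open>
  A connection would assign to the radial path \<open>s \<mapsto> [s e\<^sup>i\<^sup>\<phi>, 0]\<close> on \<open>(0, 1)\<close> a horizontal path
  based at the parameter \<open>1/2\<close>. Since it has the same projection, its value at \<open>1/4\<close> is
  \<open>[e\<^sup>i\<^sup>\<phi>/4, \<tau>(\<phi>)]\<close> with \<open>\<tau>(\<phi>) \<in> R\<close>. This real number is unique because an irrational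
  rotation acts freely away from the origin (\<open>W_class_fibre_inject\<close>).

  Smoothness of the connection makes \<open>\<tau>\<close> continuous (\<open>continuous_fibre_coordinate\<close>): a plot of
  \<open>W\<^sub>\<alpha>\<close> lifts locally to a plot of \<open>D \<times> R\<close>, and the integer that compares such a lift
  with a given continuous one is locally constant, because it is read off from a continuous
  function with values in the countable set \<open>{e\<^bsup>2\<pi>in\<alpha>\<^esup>}\<close>.

  On the other hand, rotating the radial path by the angle \<open>2\<pi>n\<alpha>\<close> amounts to acting on it by the
  path \<open>s \<mapsto> -n s\<^sup>2\<close> of the structure group (\<open>radial_rotate\<close>). The reduction axiom then forces
  \<open>\<tau>\<close> to change by \<open>n ((1/4)\<^sup>2 - (1/2)\<^sup>2)\<close>, which is unbounded in \<open>n\<close>. But the angle can be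
  taken modulo \<open>2\<pi>\<close>, and \<open>\<tau>\<close> is bounded on the compact interval \<open>[0, 2\<pi>]\<close>.
\<close>


section \<open>Calculus of smooth functions on Euclidean domains\<close>

lemma openin_Euclidean_space_iff:
  "openin (Euclidean_space n) U \<longleftrightarrow> (\<exists>V. open V \<and> U = V \<inter> topspace (Euclidean_space n))"
  by (auto simp: Euclidean_space_def openin_subtopology euclidean_product_topology)

lemma topspace_Euclidean_space_iff: "x \<in> topspace (Euclidean_space n) \<longleftrightarrow> (\<forall>i\<ge>n. x i = 0)"
  by (simp add: topspace_Euclidean_space)

lemma eventually_coordinate_update:
  assumes "openin (Euclidean_space n) U" "x \<in> U" "i < n"
  shows "eventually (\<lambda>t. x(i := t) \<in> U) (nhds (x i))"
proof -
  obtain V where V: "open V" "U = V \<inter> topspace (Euclidean_space n)"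
    using assms(1) by (auto simp: openin_Euclidean_space_iff)
  have "continuous_on UNIV (\<lambda>t. x(i := t))"
  proof (rule continuous_on_coordinatewise_then_product)
    show "continuous_on UNIV (\<lambda>t. (x(i := t)) j)" for j
      by (cases "j = i") auto
  qed
  then have "open ((\<lambda>t. x(i := t)) -` V)"
    using V(1) by (simp add: continuous_on_open_vimage)
  moreover have "x i \<in> (\<lambda>t. x(i := t)) -` V"
    using assms(2) V by simp
  ultimately have "eventually (\<lambda>t. t \<in> (\<lambda>t. x(i := t)) -` V) (nhds (x i))"
    by (rule eventually_nhds_in_open)
  then show ?thesis
    by (rule eventually_mono) (use V(2) assms in \<open>auto simp: topspace_Euclidean_space_iff\<close>)
qed

text \<open>
  Parametrizations are partial maps, so the functions tested for smoothness have junk values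
  outside their domain. Openness of the domain makes these harmless.
\<close>
lemma smooth_on_cong:
  assumes U: "openin (Euclidean_space n) U" and eq: "\<And>x. x \<in> U \<Longrightarrow> f x = g x"
    and f: "smooth_on n U f"
  shows "smooth_on n U g"
proof -
  have "Ck_on k n U g" if "Ck_on k n U f" for k
  proof (cases k)
    case 0
    with that show ?thesis
      using eq by (simp cong: continuous_on_cong)
  next
    case (Suc l)
    have der: "((\<lambda>t. g (x(i := t))) has_real_derivative D) (at (x i))"
      if "((\<lambda>t. f (x(i := t))) has_real_derivative D) (at (x i))" "x \<in> U" "i < n" for x i D
    proof -
      have "eventually (\<lambda>t. f (x(i := t)) = g (x(i := t))) (nhds (x i))"
        using eventually_coordinate_update[OF U that(2,3)] by (rule eventually_mono) (rule eq)
      from DERIV_cong_ev[OF refl this refl] that(1) show ?thesis by simp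
    qed
    have "continuous_on U g"
      using that Suc eq by (simp cong: continuous_on_cong)
    then show ?thesis
      using that der unfolding Suc Ck_on.simps by blast
  qed
  with f show ?thesis
    by (simp add: smooth_on_def)
qed

lemma smooth_on_imp_continuous_on: "smooth_on n U f \<Longrightarrow> continuous_on U f"
  unfolding smooth_on_def by (metis Ck_on.simps(1))

lemma Ck_on_const: "Ck_on k n U (\<lambda>x. c)"
proof (induction k arbitrary: c)
  case (Suc k)
  then show ?case by (auto intro!: exI[of _ "\<lambda>x. 0"])
qed simp

lemma Ck_on_coordinate: "Ck_on k n U (\<lambda>x. x j)"
proof (cases k)
  case (Suc l)
  have "((\<lambda>t. (x(i := t)) j) has_real_derivative (if i = j then 1 else 0)) (at (x i))"
    for x :: "nat \<Rightarrow> real" and i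
    by auto
  then show ?thesis
    unfolding Suc Ck_on.simps
    by (auto intro!: exI[of _ "\<lambda>x. _"] Ck_on_const continuous_on_subset[OF continuous_on_product_coordinates])
qed (auto intro: continuous_on_subset[OF continuous_on_product_coordinates])

lemma Ck_on_SucD: "Ck_on (Suc k) n U f \<Longrightarrow> Ck_on k n U f"
proof (induction k arbitrary: f)
  case (Suc k)
  then show ?case
    unfolding Ck_on.simps(2)[of "Suc k"] Ck_on.simps(2)[of k] by blast
qed simp

lemma Ck_on_add:
  assumes "Ck_on k n U f" "Ck_on k n U g"
  shows "Ck_on k n U (\<lambda>x. f x + g x)"
  using assms
proof (induction k arbitrary: f g)
  case (Suc k)
  have "\<exists>h'. (\<forall>x\<in>U. ((\<lambda>t. f (x(i := t)) + g (x(i := t))) has_real_derivative h' x) (at (x i))) \<and>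
      Ck_on k n U h'" if i: "i < n" for i
  proof -
    obtain f' where f': "\<forall>x\<in>U. ((\<lambda>t. f (x(i := t))) has_real_derivative f' x) (at (x i))"
      "Ck_on k n U f'" using Suc.prems(1) i by auto
    obtain g' where g': "\<forall>x\<in>U. ((\<lambda>t. g (x(i := t))) has_real_derivative g' x) (at (x i))"
      "Ck_on k n U g'" using Suc.prems(2) i by auto
    have "\<forall>x\<in>U. ((\<lambda>t. f (x(i := t)) + g (x(i := t))) has_real_derivative f' x + g' x) (at (x i))"
      using f'(1) g'(1) by (auto intro: DERIV_add)
    with Suc.IH[OF f'(2) g'(2)] show ?thesis by (intro exI conjI)
  qed
  then show ?case
    using Suc.prems by (auto intro: continuous_on_add)
qed (auto intro: continuous_on_add)

lemma Ck_on_mult: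
  assumes "Ck_on k n U f" "Ck_on k n U g"
  shows "Ck_on k n U (\<lambda>x. f x * g x)"
  using assms
proof (induction k arbitrary: f g)
  case (Suc k)
  have "\<exists>h'. (\<forall>x\<in>U. ((\<lambda>t. f (x(i := t)) * g (x(i := t))) has_real_derivative h' x) (at (x i))) \<and>
      Ck_on k n U h'" if i: "i < n" for i
  proof -
    obtain f' where f': "\<forall>x\<in>U. ((\<lambda>t. f (x(i := t))) has_real_derivative f' x) (at (x i))"
      "Ck_on k n U f'" using Suc.prems(1) i by auto
    obtain g' where g': "\<forall>x\<in>U. ((\<lambda>t. g (x(i := t))) has_real_derivative g' x) (at (x i))"
      "Ck_on k n U g'" using Suc.prems(2) i by auto
    have "((\<lambda>t. f (x(i := t)) * g (x(i := t))) has_real_derivative f' x * g x + g' x * f x) (at (x i))"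
      if "x \<in> U" for x
      using DERIV_mult[OF f'(1)[rule_format, OF that] g'(1)[rule_format, OF that]] by simp
    moreover have "Ck_on k n U (\<lambda>x. f' x * g x + g' x * f x)"
      using Suc.IH Suc.prems[THEN Ck_on_SucD] f'(2) g'(2) by (intro Ck_on_add) auto
    ultimately show ?thesis by (intro exI conjI ballI)
  qed
  then show ?case
    using Suc.prems by (auto intro: continuous_on_mult)
qed (auto intro: continuous_on_mult)

text \<open>
  Writing the derivative of the cosine as a phase shift keeps the induction within one family
  of functions, and the sine belongs to this family as well.
\<close>
lemma Ck_on_cos: "Ck_on k n U (\<lambda>x. cos (x j + c))"
proof (induction k arbitrary: c)
  case 0
  show ?case
    by (auto intro!: continuous_intros continuous_on_subset[OF continuous_on_product_coordinates])
next
  case (Suc k)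
  let ?h = "\<lambda>i x. (if i = j then 1 else 0) * cos (x j + (c + pi / 2))"
  have "((\<lambda>t. cos ((x(i := t)) j + c)) has_real_derivative ?h i x) (at (x i))"
    for x :: "nat \<Rightarrow> real" and i
    by (cases "i = j") (auto intro!: derivative_eq_intros simp: cos_add sin_add algebra_simps)
  moreover have "Ck_on k n U (?h i)" for i
    by (intro Ck_on_mult Ck_on_const Suc)
  moreover have "continuous_on U (\<lambda>x. cos (x j + c))"
    by (auto intro!: continuous_intros continuous_on_subset[OF continuous_on_product_coordinates])
  ultimately show ?case
    unfolding Ck_on.simps by (intro conjI allI impI exI[of _ "?h _"] ballI)
qed

lemma smooth_on_const: "smooth_on n U (\<lambda>x. c)"
  by (simp add: smooth_on_def Ck_on_const)

lemma smooth_on_coordinate: "smooth_on n U (\<lambda>x. x j)"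
  by (simp add: smooth_on_def Ck_on_coordinate)

lemma smooth_on_mult: "smooth_on n U f \<Longrightarrow> smooth_on n U g \<Longrightarrow> smooth_on n U (\<lambda>x. f x * g x)"
  by (simp add: smooth_on_def Ck_on_mult)

lemma smooth_on_cos: "smooth_on n U (\<lambda>x. cos (x j))"
  using Ck_on_cos[of _ n U j 0] by (simp add: smooth_on_def)

lemma smooth_on_sin: "smooth_on n U (\<lambda>x. sin (x j))"
proof -
  have "cos (y + (- (pi / 2))) = sin y" for y :: real
    unfolding cos_add by simp
  then show ?thesis
    using Ck_on_cos[of _ n U j "- (pi / 2)"] by (simp add: smooth_on_def)
qed


section \<open>Points and plots of the total space\<close>

abbreviation W_class :: "real \<Rightarrow> complex \<Rightarrow> real \<Rightarrow> (complex \<times> real) set" where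
  "W_class \<alpha> z t \<equiv> W_rel \<alpha> `` {(z, t)}"

lemma W_class_eq_iff:
  assumes "z \<in> disc" "w \<in> disc"
  shows "W_class \<alpha> z t = W_class \<alpha> w u \<longleftrightarrow>
    (\<exists>n. w = rot \<alpha> n z \<and> u = t + of_int n * (cmod z)\<^sup>2)"
  using eq_equiv_class_iff[OF equiv_W_rel, of "(z, t)" "(w, u)" \<alpha>] assms
  by (auto simp: orbit_rel_def twist_def)

lemma rot_left_cancel:
  assumes "\<alpha> \<notin> \<rat>" "z \<noteq> 0" "rot \<alpha> m z = rot \<alpha> n z"
  shows "m = n"
proof (rule ccontr)
  assume "m \<noteq> n"
  have "exp (\<i> * of_real (2 * pi * of_int m * \<alpha>)) = exp (\<i> * of_real (2 * pi * of_int n * \<alpha>))"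
    using assms(2,3) by (simp add: rot_def)
  then obtain k :: int where
    "\<i> * of_real (2 * pi * of_int m * \<alpha>) = \<i> * of_real (2 * pi * of_int n * \<alpha>) + of_int (2 * k) * pi * \<i>"
    unfolding exp_eq by blast
  then have "Im (\<i> * of_real (2 * pi * of_int m * \<alpha>)) =
      Im (\<i> * of_real (2 * pi * of_int n * \<alpha>) + of_int (2 * k) * pi * \<i>)"
    by (rule arg_cong)
  then have "2 * pi * (of_int m * \<alpha>) = 2 * pi * (of_int n * \<alpha> + of_int k)"
    by (simp add: algebra_simps)
  then have "of_int m * \<alpha> = of_int n * \<alpha> + of_int k"
    using pi_gt_zero by (metis mult_cancel_left mult_eq_0_iff pi_neq_zero zero_neq_numeral)
  then have "\<alpha> = of_int k / of_int (m - n)"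
    using \<open>m \<noteq> n\<close> by (simp add: field_simps)
  then show False
    using assms(1) by (metis Rats_divide Rats_of_int)
qed

text \<open>
  An irrational rotation has no periodic points besides the origin, so no identification takes
  place inside the fibre line over a nonzero point.
\<close>
lemma W_class_fibre_inject:
  assumes "\<alpha> \<notin> \<rat>" "z \<in> disc" "z \<noteq> 0" "W_class \<alpha> z t = W_class \<alpha> z u"
  shows "t = u"
proof -
  obtain n where n: "z = rot \<alpha> n z" "u = t + of_int n * (cmod z)\<^sup>2"
    using assms W_class_eq_iff by blast
  then have "n = 0"
    using rot_left_cancel[of \<alpha> z n 0] assms by simp
  with n show ?thesis by simp
qed

lemma W_proj_fibre:
  assumes "y \<in> points (W_space \<alpha>)" "z \<in> disc" "W_proj \<alpha> y = W_proj \<alpha> (W_class \<alpha> z 0)"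
  obtains t where "y = W_class \<alpha> z t"
proof -
  obtain w u where w: "w \<in> disc" "y = W_class \<alpha> w u"
    using assms(1)
    by (auto simp: W_space_def quotient_diff_def prod_diff_def sub_diff_def complex_diff_def
        real_diff_def elim!: quotientE)
  with assms have "D_rel \<alpha> `` {w} = D_rel \<alpha> `` {z}"
    by (simp add: W_proj_class)
  with assms w have "(w, z) \<in> D_rel \<alpha>"
    using eq_equiv_class_iff[OF equiv_D_rel] by metis
  then obtain n where n: "z = rot \<alpha> n w"
    by (auto simp: orbit_rel_def)
  have "y = W_class \<alpha> z (u + of_int n * (cmod w)\<^sup>2)"
    unfolding w(2) using W_class_eq_iff[OF w(1) assms(2)] n by blast
  then show ?thesis by (rule that)
qed

lemma W_plotI:
  assumes U: "openin (Euclidean_space n) (dom p)"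
    and sm: "smooth_on n (dom p) X" "smooth_on n (dom p) Y" "smooth_on n (dom p) T"
    and p: "\<And>x. x \<in> dom p \<Longrightarrow> Complex (X x) (Y x) \<in> disc \<and>
      p x = Some (W_class \<alpha> (Complex (X x) (Y x)) (T x))"
  shows "p \<in> plots (W_space \<alpha>) n"
proof -
  define q where "q = (\<lambda>x. if x \<in> dom p then Some (Complex (X x) (Y x), T x) else None)"
  have q: "dom q = dom p"
    by (auto simp: q_def dom_def)
  have "q \<in> plots (prod_diff (sub_diff complex_diff disc) real_diff) n"
  proof -
    have "smooth_on n (dom p) (\<lambda>x. Re (the ((map_option fst \<circ> q) x)))"
      "smooth_on n (dom p) (\<lambda>x. Im (the ((map_option fst \<circ> q) x)))"
      "smooth_on n (dom p) (\<lambda>x. the ((map_option snd \<circ> q) x))"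
      by (rule smooth_on_cong[OF U _ sm(1)] smooth_on_cong[OF U _ sm(2)]
          smooth_on_cong[OF U _ sm(3)]; simp add: q_def)+
    moreover have "ran (map_option fst \<circ> q) \<subseteq> disc"
      using p by (auto simp: q_def ran_def split: if_splits)
    ultimately show ?thesis
      using U by (simp add: prod_diff_def sub_diff_def complex_diff_def real_diff_def q)
  qed
  moreover have "map_option (\<lambda>a. W_rel \<alpha> `` {a}) \<circ> q \<subseteq>\<^sub>m p"
    using p by (auto simp: map_le_def q_def dom_def split: if_splits)
  ultimately show ?thesis
    unfolding W_space_def quotient_diff_def using U q by (auto intro!: bexI[of _ q])
qed

text \<open>
  The local lifts of \<open>p\<close> provided by the quotient diffeology are continuous, but need not be
  the given representatives \<open>(z x, \<tau> x)\<close>. They differ from these by integers, which are locally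
  constant because a connected countable set of rotation factors is a single point.
\<close>
lemma continuous_fibre_coordinate:
  fixes I :: "real set"
  assumes \<alpha>: "\<alpha> \<notin> \<rat>" and p: "p \<in> plots (W_space \<alpha>) n"
    and I: "open I" and c: "continuous_on I c" and z: "continuous_on I z"
    and zd: "\<And>x. x \<in> I \<Longrightarrow> z x \<in> disc - {0}"
    and pc: "\<And>x. x \<in> I \<Longrightarrow> p (c x) = Some (W_class \<alpha> (z x) (\<tau> x))"
  shows "continuous_on I \<tau>"
proof -
  have "isCont \<tau> x0" if x0: "x0 \<in> I" for x0
  proof -
    have domp: "openin (Euclidean_space n) (dom p)"
      and lifts: "\<forall>x\<in>dom p. \<exists>q\<in>plots (prod_diff (sub_diff complex_diff disc) real_diff) n.
        x \<in> dom q \<and> map_option (\<lambda>a. W_rel \<alpha> `` {a}) \<circ> q \<subseteq>\<^sub>m p"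
      using p by (auto simp: W_space_def quotient_diff_def)
    have cdom: "c x \<in> dom p" if "x \<in> I" for x
      using pc[OF that] by auto
    obtain q where q: "q \<in> plots (prod_diff (sub_diff complex_diff disc) real_diff) n"
      "c x0 \<in> dom q" "map_option (\<lambda>a. W_rel \<alpha> `` {a}) \<circ> q \<subseteq>\<^sub>m p"
      using lifts cdom[OF x0] by blast
    define Z where "Z = (\<lambda>y. fst (the (q y)))"
    define T where "T = (\<lambda>y. snd (the (q y)))"
    have openq: "openin (Euclidean_space n) (dom q)"
      and sm: "smooth_on n (dom q) (\<lambda>y. Re (the ((map_option fst \<circ> q) y)))"
        "smooth_on n (dom q) (\<lambda>y. Im (the ((map_option fst \<circ> q) y)))"
        "smooth_on n (dom q) (\<lambda>y. the ((map_option snd \<circ> q) y))"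
      and ranq: "ran (map_option fst \<circ> q) \<subseteq> disc"
      using q(1) by (auto simp: prod_diff_def sub_diff_def complex_diff_def real_diff_def)
    have "continuous_on (dom q) (\<lambda>y. Re (Z y))"
      by (rule continuous_on_eq[OF sm(1)[THEN smooth_on_imp_continuous_on]]) (auto simp: Z_def)
    moreover have "continuous_on (dom q) (\<lambda>y. Im (Z y))"
      by (rule continuous_on_eq[OF sm(2)[THEN smooth_on_imp_continuous_on]]) (auto simp: Z_def)
    ultimately have Z: "continuous_on (dom q) Z"
      by (auto dest: continuous_on_Complex)
    have T: "continuous_on (dom q) T"
      by (rule continuous_on_eq[OF sm(3)[THEN smooth_on_imp_continuous_on]]) (auto simp: T_def)
    obtain V where V: "open V" "dom q = V \<inter> topspace (Euclidean_space n)"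
      using openq by (auto simp: openin_Euclidean_space_iff)
    have "open (c -` V \<inter> I)"
      using continuous_on_open_vimage[OF I] c V(1) by blast
    moreover have "x0 \<in> c -` V \<inter> I"
      using x0 q(2) V(2) by auto
    ultimately obtain e where e: "e > 0" "ball x0 e \<subseteq> c -` V \<inter> I"
      using open_contains_ball by blast
    define J where "J = ball x0 e"
    have JI: "J \<subseteq> I" and cJ: "c ` J \<subseteq> dom q"
      using e(2) V(2) cdom openin_subset[OF domp] unfolding J_def by blast+
    have "\<exists>N. Z (c x) = rot \<alpha> N (z x) \<and> T (c x) = \<tau> x + of_int N * (cmod (z x))\<^sup>2"
      if x: "x \<in> J" for x
    proof -
      have xq: "c x \<in> dom q" "x \<in> I" using x cJ JI by auto
      then have qc: "q (c x) = Some (Z (c x), T (c x))"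
        by (auto simp: Z_def T_def)
      then have "Z (c x) \<in> disc"
        using ranq by (force simp: ran_def)
      moreover have "W_class \<alpha> (z x) (\<tau> x) = W_class \<alpha> (Z (c x)) (T (c x))"
        using q(3) pc[OF xq(2)] qc by (force simp: map_le_def dom_def)
      ultimately show ?thesis
        using W_class_eq_iff zd[OF xq(2)] by blast
    qed
    then obtain N where N: "\<And>x. x \<in> J \<Longrightarrow> Z (c x) = rot \<alpha> (N x) (z x)"
      "\<And>x. x \<in> J \<Longrightarrow> T (c x) = \<tau> x + of_int (N x) * (cmod (z x))\<^sup>2"
      by metis
    have cJc: "continuous_on J c" and zJ: "continuous_on J z"
      using c z JI continuous_on_subset by blast+
    have ZJ: "continuous_on J (\<lambda>x. Z (c x))" and TJ: "continuous_on J (\<lambda>x. T (c x))"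
      using continuous_on_compose2[OF Z cJc cJ] continuous_on_compose2[OF T cJc cJ] by auto
    let ?r = "\<lambda>x. Z (c x) / z x"
    have "continuous_on J ?r"
      using ZJ zJ zd JI by (intro continuous_on_divide) auto
    then have "connected (?r ` J)"
      by (rule connected_continuous_image) (simp add: J_def)
    moreover have r: "?r x = rot \<alpha> (N x) 1" if "x \<in> J" for x
      using that N(1) zd JI by (auto simp: rot_def)
    then have "?r ` J \<subseteq> range (\<lambda>k. rot \<alpha> k 1)"
      by auto
    then have "countable (?r ` J)"
      by (rule countable_subset) simp
    moreover have x0J: "x0 \<in> J"
      using e(1) by (simp add: J_def)
    ultimately have const: "?r x = ?r x0" if "x \<in> J" for x
      using connected_uncountable[of "?r ` J" "?r x" "?r x0"] that by blast
    have "N x = N x0" if "x \<in> J" for x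
    proof (rule rot_left_cancel[OF \<alpha>])
      show "rot \<alpha> (N x) 1 = rot \<alpha> (N x0) 1"
        using const[OF that] r[OF that] r[OF x0J] by metis
    qed simp
    then have "\<tau> x = T (c x) - of_int (N x0) * (cmod (z x))\<^sup>2" if "x \<in> J" for x
      using N(2)[OF that] that by simp
    moreover have "continuous_on J (\<lambda>x. T (c x) - of_int (N x0) * (cmod (z x))\<^sup>2)"
      by (intro continuous_intros TJ zJ)
    ultimately have "continuous_on J \<tau>"
      by (simp cong: continuous_on_cong)
    then show ?thesis
      using x0J continuous_on_eq_continuous_at[of J \<tau>] by (simp add: J_def)
  qed
  then show ?thesis
    by (simp add: continuous_at_imp_continuous_on)
qed


section \<open>Radial paths\<close>

definition radial :: "real \<Rightarrow> real \<Rightarrow> real \<rightharpoonup> (complex \<times> real) set" where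
  "radial \<alpha> \<phi> s = (if 0 < s \<and> s < 1 then Some (W_class \<alpha> (of_real s * cis \<phi>) 0) else None)"

lemma dom_radial: "dom (radial \<alpha> \<phi>) = {0<..<1}"
  by (auto simp: radial_def dom_def)

lemma radial_point_in_disc: "0 < s \<Longrightarrow> s < 1 \<Longrightarrow> of_real s * cis \<phi> \<in> disc"
  by (simp add: disc_def norm_mult)

lemma of_real_mult_cis: "of_real s * cis \<phi> = Complex (s * cos \<phi>) (s * sin \<phi>)"
  by (simp add: complex_eq_iff)

lemma radial_in_local_paths: "radial \<alpha> \<phi> \<in> local_paths (W_space \<alpha>)"
proof -
  let ?f = "\<lambda>t. the (radial \<alpha> \<phi> t)"
  have "map_option ?f \<circ> p \<in> plots (W_space \<alpha>) n"
    if p: "p \<in> plots (sub_diff real_diff (dom (radial \<alpha> \<phi>))) n" for n p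
  proof (rule W_plotI)
    have U: "openin (Euclidean_space n) (dom p)" "smooth_on n (dom p) (\<lambda>x. the (p x))"
      and ran: "ran p \<subseteq> {0<..<1}"
      using p by (auto simp: sub_diff_def real_diff_def dom_radial)
    show "openin (Euclidean_space n) (dom (map_option ?f \<circ> p))"
      using U by simp
    show "smooth_on n (dom (map_option ?f \<circ> p)) (\<lambda>x. the (p x) * cos \<phi>)"
      "smooth_on n (dom (map_option ?f \<circ> p)) (\<lambda>x. the (p x) * sin \<phi>)"
      "smooth_on n (dom (map_option ?f \<circ> p)) (\<lambda>x. 0)"
      unfolding dom_map_option_comp by (intro smooth_on_mult smooth_on_const U)+
    fix x assume "x \<in> dom (map_option ?f \<circ> p)"
    then obtain s where "p x = Some s"
      by (auto simp: dom_def)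
    moreover from this have "0 < s" "s < 1"
      using ran by (auto simp: ran_def)
    ultimately show "Complex (the (p x) * cos \<phi>) (the (p x) * sin \<phi>) \<in> disc \<and>
        (map_option ?f \<circ> p) x = Some (W_class \<alpha> (Complex (the (p x) * cos \<phi>) (the (p x) * sin \<phi>)) 0)"
      using radial_point_in_disc[of s \<phi>] by (simp add: radial_def of_real_mult_cis)
  qed
  moreover have "?f t \<in> points (W_space \<alpha>)" if "0 < t" "t < 1" for t
    using that radial_point_in_disc[of t \<phi>]
    by (auto simp: W_space_def quotient_diff_def prod_diff_def sub_diff_def complex_diff_def
        real_diff_def radial_def intro!: quotientI)
  ultimately show ?thesis
    by (auto simp: local_paths_def smooth_map_def dom_radial sub_diff_def real_diff_def
        is_interval_convex_1)
qed

lemma radial_in_tbPaths: "t \<in> {0<..<1} \<Longrightarrow> (radial \<alpha> \<phi>, t) \<in> points (tbPaths_loc (W_space \<alpha>))"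
  using radial_in_local_paths
  by (auto simp: tbPaths_loc_def sub_diff_def prod_diff_def Paths_loc_def real_diff_def dom_radial)

lemma radial_family_plot:
  assumes t: "t \<in> {0<..<1}"
  shows "(\<lambda>x. if x \<in> topspace (Euclidean_space 1) then Some (radial \<alpha> (x 0), t) else None)
    \<in> plots (tbPaths_loc (W_space \<alpha>)) 1"
    (is "?P \<in> _")
proof -
  let ?R = "\<lambda>x. if x \<in> topspace (Euclidean_space 1) then Some (radial \<alpha> (x 0)) else None"
  let ?u = "uncurry_family 1 ?R"
  have fst: "map_option fst \<circ> ?P = ?R"
    and snd: "map_option snd \<circ> ?P = (\<lambda>x. if x \<in> topspace (Euclidean_space 1) then Some t else None)"
    by auto
  have domR: "dom ?R = topspace (Euclidean_space 1)"
    by (auto simp: dom_def)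
  have u: "?u x = (if x \<in> topspace (Euclidean_space 2) \<and> 0 < x 1 \<and> x 1 < 1
      then Some (W_class \<alpha> (of_real (x 1) * cis (x 0)) 0) else None)" for x
  proof -
    have "x(1 := 0) \<in> topspace (Euclidean_space 1) \<longleftrightarrow> x \<in> topspace (Euclidean_space 2)"
      unfolding topspace_Euclidean_space_iff
      by (metis One_nat_def Suc_1 fun_upd_other fun_upd_same le_Suc_eq not_less_eq_eq order_refl)
    then show ?thesis
      by (auto simp: uncurry_family_def radial_def)
  qed
  then have domu: "dom ?u = {x. 0 < x 1 \<and> x 1 < 1} \<inter> topspace (Euclidean_space 2)"
    by (auto simp: dom_def split: if_splits)
  have "open {x :: nat \<Rightarrow> real. 0 < x 1 \<and> x 1 < 1}"
    by (intro open_Collect_conj open_Collect_less continuous_intros) simp_all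
  then have openu: "openin (Euclidean_space 2) (dom ?u)"
    unfolding openin_Euclidean_space_iff domu by blast
  have plotu: "?u \<in> plots (W_space \<alpha>) 2"
  proof (rule W_plotI[OF openu])
    show "smooth_on 2 (dom ?u) (\<lambda>x. x 1 * cos (x 0))" "smooth_on 2 (dom ?u) (\<lambda>x. x 1 * sin (x 0))"
      "smooth_on 2 (dom ?u) (\<lambda>x. 0)"
      by (intro smooth_on_mult smooth_on_coordinate smooth_on_cos smooth_on_sin smooth_on_const)+
    fix x assume "x \<in> dom ?u"
    then show "Complex (x 1 * cos (x 0)) (x 1 * sin (x 0)) \<in> disc \<and>
        ?u x = Some (W_class \<alpha> (Complex (x 1 * cos (x 0)) (x 1 * sin (x 0))) 0)"
      using radial_point_in_disc[of "x 1" "x 0"] u domu by (auto simp: of_real_mult_cis)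
  qed
  have "?R \<in> plots (Paths_loc (W_space \<alpha>)) 1"
  proof -
    have "openin (Euclidean_space 1) (dom ?R)"
      unfolding domR by (rule openin_topspace)
    moreover have "ran ?R \<subseteq> local_paths (W_space \<alpha>)"
      using radial_in_local_paths by (auto simp: ran_def)
    ultimately show ?thesis
      using openu plotu unfolding Paths_loc_def Suc_1[symmetric] by simp
  qed
  moreover have "map_option snd \<circ> ?P \<in> plots real_diff 1"
  proof -
    have "dom (map_option snd \<circ> ?P) = topspace (Euclidean_space 1)"
      by (auto simp: dom_def)
    then show ?thesis
      unfolding real_diff_def
      by (auto simp: snd intro!: smooth_on_cong[OF openin_topspace _ smooth_on_const[of _ _ t]])
  qed
  moreover have "ran ?P \<subseteq> {(\<gamma>, t). t \<in> dom \<gamma>}"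
  proof -
    have "t \<in> dom (radial \<alpha> \<phi>)" for \<phi>
      using t by (simp add: dom_radial)
    then show ?thesis
      by (auto simp: ran_def split: if_splits)
  qed
  ultimately show ?thesis
    unfolding tbPaths_loc_def sub_diff_def prod_diff_def using fst by simp
qed

text \<open>
  This is where the twist \<open>t + n|z|\<^sup>2\<close> in the action on \<open>D \<times> R\<close> enters: in \<open>W\<^sub>\<alpha>\<close> one has
  \<open>[s e\<^bsup>2\<pi>in\<alpha>\<^esup>, 0] = [s, -n s\<^sup>2]\<close>.
\<close>
lemma radial_rotate:
  assumes "cis \<phi> = cis (2 * pi * of_int n * \<alpha>)"
  shows "radial \<alpha> \<phi> = (\<lambda>s. map_option (W_act \<alpha> (- of_int n * s\<^sup>2)) (radial \<alpha> 0 s))"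
proof
  fix s
  show "radial \<alpha> \<phi> s = map_option (W_act \<alpha> (- of_int n * s\<^sup>2)) (radial \<alpha> 0 s)"
  proof (cases "0 < s \<and> s < 1")
    case True
    then have "of_real s \<in> disc" "of_real s * cis \<phi> \<in> disc"
      using radial_point_in_disc[of s] by (auto simp: disc_def norm_mult)
    moreover have "of_real s * cis \<phi> = rot \<alpha> n (of_real s)"
      unfolding assms by (simp add: rot_def cis_conv_exp)
    moreover have "0 = - of_int n * s\<^sup>2 + of_int n * (cmod (of_real s))\<^sup>2"
      by simp
    ultimately have "W_class \<alpha> (of_real s) (- of_int n * s\<^sup>2) = W_class \<alpha> (of_real s * cis \<phi>) 0"
      using W_class_eq_iff by blast
    then show ?thesis
      using True \<open>of_real s \<in> disc\<close> by (simp add: radial_def W_act_class)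
  qed (auto simp: radial_def)
qed

lemma smooth_map_quadratic: "smooth_map (sub_diff real_diff A) real_diff (\<lambda>s. a * s\<^sup>2)"
proof -
  have "map_option (\<lambda>s. a * s\<^sup>2) \<circ> p \<in> plots real_diff n" if "p \<in> plots real_diff n" for n p
  proof -
    have U: "openin (Euclidean_space n) (dom p)" "smooth_on n (dom p) (\<lambda>x. the (p x))"
      using that by (auto simp: real_diff_def)
    have "smooth_on n (dom p) (\<lambda>x. a * (the (p x) * the (p x)))"
      by (intro smooth_on_mult smooth_on_const U)
    then have "smooth_on n (dom p) (\<lambda>x. the ((map_option (\<lambda>s. a * s\<^sup>2) \<circ> p) x))"
      by (rule smooth_on_cong[OF U(1), rotated]) (auto simp: power2_eq_square)
    then show ?thesis
      using U(1) by (simp add: real_diff_def)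
  qed
  then show ?thesis
    by (auto simp: smooth_map_def sub_diff_def real_diff_def)
qed


section \<open>Unbounded fibre coordinates of a horizontal family\<close>

theorem mainTheorem2:
  fixes \<alpha> :: real
  assumes "\<alpha> \<notin> \<rat>"
  shows "\<not> (\<exists>\<Theta>. is_connection (W_bundle \<alpha>) \<Theta>)"
proof
  assume "\<exists>\<Theta>. is_connection (W_bundle \<alpha>) \<Theta>"
  then obtain \<Theta> where \<Theta>: "is_connection (W_bundle \<alpha>) \<Theta>" ..
  let ?W = "W_space \<alpha>"
  define hor where "hor \<phi> = \<Theta> (radial \<alpha> \<phi>, 1/2)" for \<phi>
  define z :: "real \<Rightarrow> complex" where "z \<phi> = of_real (1/4) * cis \<phi>" for \<phi>
  have z: "z \<phi> \<in> disc" "z \<phi> \<noteq> 0" for \<phi>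
    by (auto simp: z_def disc_def norm_mult)
  have smooth: "smooth_map (tbPaths_loc ?W) (Paths_loc ?W) \<Theta>"
    using \<Theta> by (simp add: is_connection_def W_bundle_def)
  have rad: "(radial \<alpha> \<phi>, 1/2) \<in> points (tbPaths_loc ?W)" for \<phi>
    by (rule radial_in_tbPaths) simp
  have conn: "\<forall>(\<gamma>, t\<^sub>0) \<in> points (tbPaths_loc ?W). dom (\<Theta> (\<gamma>, t\<^sub>0)) = dom \<gamma> \<and>
      map_option (W_proj \<alpha>) \<circ> \<Theta> (\<gamma>, t\<^sub>0) = map_option (W_proj \<alpha>) \<circ> \<gamma> \<and>
      (\<forall>g. smooth_map (sub_diff real_diff (dom \<gamma>)) real_diff g \<longrightarrow>
        \<Theta> (\<lambda>t. map_option (W_act \<alpha> (g t)) (\<gamma> t), t\<^sub>0) = map_option (W_act \<alpha> (g t\<^sub>0)) \<circ> \<Theta> (\<gamma>, t\<^sub>0))"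
    using \<Theta> unfolding is_connection_def W_bundle_def gbundle.simps by blast
  have dom: "dom (hor \<phi>) = {0<..<1}"
    and lift: "map_option (W_proj \<alpha>) \<circ> hor \<phi> = map_option (W_proj \<alpha>) \<circ> radial \<alpha> \<phi>"
    and red: "smooth_map (sub_diff real_diff {0<..<1}) real_diff g \<Longrightarrow>
      \<Theta> (\<lambda>t. map_option (W_act \<alpha> (g t)) (radial \<alpha> \<phi> t), 1/2) =
      map_option (W_act \<alpha> (g (1/2))) \<circ> hor \<phi>" for \<phi> g
    using bspec[OF conn rad[of \<phi>]] by (simp_all add: hor_def dom_radial)
  have "\<exists>t. hor \<phi> (1/4) = Some (W_class \<alpha> (z \<phi>) t)" for \<phi>
  proof -
    obtain y where y: "hor \<phi> (1/4) = Some y"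
      using dom[of \<phi>] domD[of "1/4" "hor \<phi>"] by auto
    have "hor \<phi> \<in> local_paths ?W"
      using smooth rad unfolding smooth_map_def hor_def by (force simp: Paths_loc_def)
    then have "the (hor \<phi> (1/4)) \<in> points ?W"
      by (auto simp: local_paths_def smooth_map_def dom sub_diff_def real_diff_def)
    moreover have "W_proj \<alpha> y = W_proj \<alpha> (W_class \<alpha> (z \<phi>) 0)"
      using fun_cong[OF lift[of \<phi>], of "1/4"] y by (simp add: radial_def z_def)
    ultimately obtain t where "y = W_class \<alpha> (z \<phi>) t"
      using y z W_proj_fibre by (metis option.sel)
    with y show ?thesis by blast
  qed
  then obtain \<tau> where \<tau>: "\<And>\<phi>. hor \<phi> (1/4) = Some (W_class \<alpha> (z \<phi>) (\<tau> \<phi>))"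
    by metis

  define P :: "(real \<rightharpoonup> (complex \<times> real) set) param" where
    "P = (\<lambda>x. if x \<in> topspace (Euclidean_space 1) then Some (hor (x 0)) else None)"
  have "P = map_option \<Theta> \<circ>
      (\<lambda>x. if x \<in> topspace (Euclidean_space 1) then Some (radial \<alpha> (x 0), 1/2) else None)"
    by (auto simp: P_def hor_def)
  then have "P \<in> plots (Paths_loc ?W) 1"
    using smooth radial_family_plot[of "1/2" \<alpha>] by (simp add: smooth_map_def)
  then have plot: "uncurry_family 1 P \<in> plots ?W (Suc 1)"
    by (simp add: Paths_loc_def)
  have "continuous_on UNIV \<tau>"
  proof (rule continuous_fibre_coordinate[OF assms plot])
    let ?c = "\<lambda>\<phi> i. if i = 0 then \<phi> else if i = 1 then 1/4 else (0 :: real)"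
    show "continuous_on UNIV ?c"
    proof (rule continuous_on_coordinatewise_then_product)
      show "continuous_on UNIV (\<lambda>\<phi>. ?c \<phi> i)" for i
        by (cases "i = 0") auto
    qed
    show "continuous_on UNIV z"
      unfolding z_def by (intro continuous_intros)
    show "z \<phi> \<in> disc - {0}" for \<phi>
      using z by simp
    show "uncurry_family 1 P (?c \<phi>) = Some (W_class \<alpha> (z \<phi>) (\<tau> \<phi>))" for \<phi>
      using \<tau> by (simp add: uncurry_family_def P_def topspace_Euclidean_space_iff)
  qed simp
  then have "compact (\<tau> ` {0..2 * pi})"
    by (intro compact_continuous_image) (auto intro: continuous_on_subset)
  then obtain B where B: "\<And>\<phi>. \<phi> \<in> {0..2 * pi} \<Longrightarrow> \<bar>\<tau> \<phi>\<bar> \<le> B"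
    using compact_imp_bounded by (fastforce simp: bounded_iff)

  \<comment> \<open>The fractional part keeps all angles in one compact interval; \<open>3/16 = (1/2)\<^sup>2 - (1/4)\<^sup>2\<close> is the
    discrepancy between the group elements \<open>-n s\<^sup>2\<close> at the base parameter and at \<open>1/4\<close>.\<close>
  have jump: "\<tau> (2 * pi * frac (of_int n * \<alpha>)) = \<tau> 0 - of_int n * (3/16)" for n
  proof -
    define \<phi> where "\<phi> = 2 * pi * frac (of_int n * \<alpha>)"
    have \<phi>: "cis \<phi> = cis (2 * pi * of_int n * \<alpha>)"
    proof -
      have "2 * pi * of_int n * \<alpha> = \<phi> + 2 * pi * of_int \<lfloor>of_int n * \<alpha>\<rfloor>"
        by (simp add: \<phi>_def frac_def algebra_simps)
      then show ?thesis
        by (simp add: cis_mult[symmetric] cis_multiple_2pi)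
    qed
    have "hor \<phi> = map_option (W_act \<alpha> (- of_int n * (1/2)\<^sup>2)) \<circ> hor 0"
      using red[of "\<lambda>s. - of_int n * s\<^sup>2" 0, OF smooth_map_quadratic] radial_rotate[OF \<phi>]
      by (simp add: hor_def)
    then have "W_class \<alpha> (z \<phi>) (\<tau> \<phi>) = W_class \<alpha> (z 0) (\<tau> 0 - of_int n / 4)"
      using \<tau>[of \<phi>] \<tau>[of 0] z by (simp add: W_act_class power2_eq_square)
    also have "\<dots> = W_class \<alpha> (z \<phi>) (\<tau> 0 - of_int n / 4 + of_int n * (cmod (z 0))\<^sup>2)"
    proof -
      have "z \<phi> = rot \<alpha> n (z 0)"
        unfolding z_def \<phi> by (simp add: rot_def cis_conv_exp)
      then show ?thesis
        using W_class_eq_iff z by blast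
    qed
    finally have "\<tau> \<phi> = \<tau> 0 - of_int n / 4 + of_int n * (cmod (z 0))\<^sup>2"
      using W_class_fibre_inject[OF assms] z by blast
    then show ?thesis
      by (simp add: \<phi>_def z_def norm_mult power2_eq_square)
  qed
  have bound: "\<bar>\<tau> 0 - of_int n * (3/16)\<bar> \<le> B" for n :: int
  proof -
    have "frac (of_int n * \<alpha>) \<in> {0..1}"
      using frac_lt_1[of "of_int n * \<alpha>"] by simp
    then have "2 * pi * frac (of_int n * \<alpha>) \<in> {0..2 * pi}"
      by (simp add: mult_left_le)
    from B[OF this] show ?thesis
      unfolding jump .
  qed
  obtain n :: int where "of_int n > (16 / 3) * (2 * B)"
    using ex_less_of_int by blast
  then show False
    using bound[of n] bound[of 0] by (auto simp: abs_le_iff)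
qed

end
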